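(* Let $x^\dagger\in X$ be a solution of $\mathcal{A}x=y$ for some $y\in\mathcal{R}(\mathcal{A})$, and for each $\delta>0$ let $y^\delta\in Y$ fulfill $\|y^\delta-y\|\leqslant\delta$. Let the network parameters $\theta(L)\in\Theta(L)$, $L\in[0,1)$, be such that the local approximation property $$\|\mathcal{A}^*\mathcal{A}x^\dagger-\varphi_{\theta(L),L}(x^\dagger)\|=\mathcal{O}\big((1-L)\,\psi(1-L)\big)\qquad(\text{as }L\to1)$$ holds for some index function $\psi$. If $L:(0,\infty)\to[0,1)$ fulfills $$L(\delta)\to1\quad\text{and}\quad\frac{\delta}{1-L(\delta)}\to0\qquad\text{for }\delta\to0,$$ then for $x^\delta_{L(\delta)}:=T_{L(\delta)}(y^\delta)=(\varphi_{\theta(L(\delta)),L(\delta)}^{-1}\circ\mathcal{A}^* )(y^\delta)$ it holds $$\|x^\delta_{L(\delta)}-x^\dagger\|\to0\qquad\text{for }\delta\to0.$$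
   Context: $X,Y$ are Hilbert spaces and $\mathcal{A}:X\to Y$ is a bounded linear operator with $\|\mathcal{A}\|=1$, adjoint $\mathcal{A}^*$ and range $\mathcal{R}(\mathcal{A})$. For each $L\in[0,1)$, $\Theta(L)$ is a parameter set, and for each $\theta\in\Theta(L)$ a (possibly nonlinear) function $f_{\theta,L}:X\to X$ with Lipschitz constant $\mathrm{Lip}(f_{\theta,L})\leqslant L$ is given; $\varphi_{\theta,L}:X\to X$ is the invertible residual network (iResNet) $\varphi_{\theta,L}(x)=x-f_{\theta,L}(x)$, which is bijective since $L<1$. The reconstruction operator is $T_L=\varphi_{\theta(L),L}^{-1}\circ\mathcal{A}^*:Y\to X$. An index function is a mapping $\psi:\mathbb{R}_{\geqslant0}\to\mathbb{R}_{\geqslant0}$ that is continuous, strictly increasing and satisfies $\psi(0)=0$. *)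

theory Defs
  imports "HOL-Analysis.Analysis" "HOL-Library.Landau_Symbols"
begin

definition index_function :: "(real \<Rightarrow> real) \<Rightarrow> bool" where
  "index_function \<psi> \<longleftrightarrow>
     \<psi> ` {0..} \<subseteq> {0..} \<and> continuous_on {0..} \<psi> \<and> strict_mono_on {0..} \<psi> \<and> \<psi> 0 = 0"

(* The residual functions f \<theta> L, for L in [0,1) and \<theta> in \<Theta> L. All parameter sets
   \<Theta> L live in one type 't, which costs no generality (take a disjoint sum). *)
definition residual_family ::
  "(real \<Rightarrow> 't set) \<Rightarrow> ('t \<Rightarrow> real \<Rightarrow> 'x::real_normed_vector \<Rightarrow> 'x) \<Rightarrow> bool" where
  "residual_family \<Theta> f \<longleftrightarrow> (\<forall>L\<in>{0..<1}. \<forall>\<theta>\<in>\<Theta> L. L-lipschitz_on UNIV (f \<theta> L))"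

definition iresnet ::
  "('t \<Rightarrow> real \<Rightarrow> 'x::real_normed_vector \<Rightarrow> 'x) \<Rightarrow> 't \<Rightarrow> real \<Rightarrow> 'x \<Rightarrow> 'x" where
  "iresnet f \<theta> L x = x - f \<theta> L x"

(* inv is the genuine inverse: on a complete space iresnet f \<theta> L is bijective whenever
   f \<theta> L is Lipschitz with constant L < 1. *)
definition reconstruction ::
  "('x::real_inner \<Rightarrow> 'y::real_inner) \<Rightarrow> ('t \<Rightarrow> real \<Rightarrow> 'x \<Rightarrow> 'x) \<Rightarrow> (real \<Rightarrow> 't) \<Rightarrow> real \<Rightarrow> 'y \<Rightarrow> 'x" where
  "reconstruction A f \<theta> L = inv (iresnet f (\<theta> L) L) \<circ> adjoint A"

end

theory Submission
  imports Defs
begin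

text \<open>
  The argument is a stability estimate. Since \<open>f \<theta> l\<close> is \<open>l\<close>-Lipschitz with \<open>l < 1\<close>, the network
  \<open>\<phi> x = x - f \<theta> l x\<close> shrinks distances by at most the factor \<open>1 - l\<close>
  (\<open>iresnet_expansive\<close>), so its inverse is Lipschitz with constant \<open>1 / (1 - l)\<close>. Comparing the
  reconstruction \<open>\<phi>\<^sup>-\<^sup>1 (A\<^sup>* y\<^sup>\<delta>)\<close> with \<open>x\<^sup>\<dagger> = \<phi>\<^sup>-\<^sup>1 (\<phi> x\<^sup>\<dagger>)\<close> and passing through
  \<open>A\<^sup>* y = A\<^sup>* A x\<^sup>\<dagger>\<close> therefore bounds the error by
  \<open>\<delta> / (1 - l) + \<parallel>A\<^sup>* A x\<^sup>\<dagger> - \<phi> x\<^sup>\<dagger>\<parallel> / (1 - l)\<close>; the first term also uses that the adjoint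
  of an operator of norm \<open>1\<close> does not increase norms (\<open>norm_adjoint_diff_le\<close>,
  \<open>reconstruction_error\<close>). At \<open>l = L \<delta>\<close> the first term vanishes in the limit by the parameter
  choice, and the second one is at most a constant times \<open>\<psi> (1 - L \<delta>)\<close>, which vanishes because
  \<open>\<psi>\<close> is continuous at \<open>0\<close> with \<open>\<psi> 0 = 0\<close>.

  Two existence facts stand behind the notation. The constant \<^const>\<open>adjoint\<close> is a Hilbert choice
  that satisfies the adjoint identity only if some map does; on a Hilbert space this follows from
  the Riesz representation theorem, proved by minimising a quadratic functional. The constant
  \<^const>\<open>inv\<close> is a right inverse only of a surjective map; surjectivity of the network is Banach's
  fixed point theorem.
\<close>

section \<open>Riesz representation and the adjoint\<close>

text \<open>
  The representing vector is the minimiser of the energy \<open>\<parallel>x\<parallel>\<^sup>2 - 2 g x\<close>: for a minimiser,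
  the derivative in every direction \<open>v\<close>, which is \<open>2 (m \<bullet> v - g v)\<close>, has to vanish. The
  parallelogram law turns any minimising sequence into a Cauchy sequence, so completeness
  provides the minimiser.
\<close>

lemma riesz_representation:
  fixes g :: "'a::{real_inner, complete_space} \<Rightarrow> real"
  assumes "bounded_linear g"
  obtains m where "\<And>v. g v = m \<bullet> v"
proof -
  interpret g: bounded_linear g by fact
  define J where "J x = x \<bullet> x - 2 * g x" for x
  define d where "d = (INF x. J x)"
  obtain K where K: "\<And>x. norm (g x) \<le> norm x * K"
    using g.bounded by blast
  \<comment> \<open>Completing the square, \<open>\<parallel>x\<parallel>\<^sup>2 - 2 K \<parallel>x\<parallel> \<ge> - K\<^sup>2\<close>.\<close>
  have J_ge: "- K\<^sup>2 \<le> J x" for x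
  proof -
    have "g x \<le> norm x * K" using K[of x] by simp
    moreover have "0 \<le> (norm x - K)\<^sup>2" by simp
    ultimately show ?thesis
      unfolding J_def power2_norm_eq_inner[symmetric] power2_diff by (simp add: algebra_simps)
  qed
  have bdd: "bdd_below (range J)"
    using J_ge by (intro bdd_belowI[of _ "- K\<^sup>2"]) auto
  have d_le: "d \<le> J x" for x
    unfolding d_def using bdd by (intro cINF_lower) auto
  have "\<exists>x. J x < d + 1 / Suc n" for n :: nat
    using cINF_less_iff[OF _ bdd, of "d + 1 / Suc n"] unfolding d_def by auto
  then obtain X where X: "\<And>n. J (X n) < d + 1 / Suc n"
    by metis
  have par: "(norm (x - z))\<^sup>2 = 2 * J x + 2 * J z - 4 * J ((1/2) *\<^sub>R (x + z))" for x z
    unfolding J_def power2_norm_eq_inner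
    by (simp add: g.scaleR g.add inner_add_left inner_add_right inner_diff_left inner_diff_right
        inner_commute algebra_simps)
  have dist_le: "(norm (X p - X q))\<^sup>2 \<le> 2 / Suc p + 2 / Suc q" for p q
    using par[of "X p" "X q"] X[of p] X[of q] d_le[of "(1/2) *\<^sub>R (X p + X q)"] by simp
  have "Cauchy X"
  proof (rule metric_CauchyI)
    fix e :: real assume e: "e > 0"
    obtain M :: nat where M: "4 / e\<^sup>2 < M"
      using reals_Archimedean2 by blast
    show "\<exists>M. \<forall>p\<ge>M. \<forall>q\<ge>M. dist (X p) (X q) < e"
    proof (intro exI allI impI)
      fix p q assume "p \<ge> M" "q \<ge> M"
      then have "2 / real (Suc p) \<le> 2 / Suc M" "2 / real (Suc q) \<le> 2 / Suc M"
        by (auto intro!: divide_left_mono)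
      then have "(norm (X p - X q))\<^sup>2 \<le> 4 / Suc M"
        using dist_le[of p q] by simp
      also have "\<dots> < e\<^sup>2"
      proof -
        have "4 < real M * e\<^sup>2" using M e by (simp add: field_simps)
        also have "\<dots> \<le> real (Suc M) * e\<^sup>2" by (intro mult_right_mono) auto
        finally show ?thesis by (simp add: field_simps)
      qed
      finally show "dist (X p) (X q) < e"
        using e by (simp add: dist_norm power2_less_imp_less)
    qed
  qed
  then obtain m where m: "X \<longlonglongrightarrow> m"
    using Cauchy_convergent convergent_def by blast
  have "(\<lambda>n. J (X n)) \<longlonglongrightarrow> J m"
    unfolding J_def by (intro tendsto_intros g.tendsto m)
  moreover have "(\<lambda>n. d + 1 / Suc n) \<longlonglongrightarrow> d + 0"
    by (intro tendsto_add tendsto_const lim_1_over_n LIMSEQ_Suc)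
  ultimately have "J m \<le> d + 0"
    using X by (intro LIMSEQ_le) (auto intro: less_imp_le)
  then have min: "J m \<le> J x" for x
    using d_le[of x] by simp
  have "g v = m \<bullet> v" for v
  proof (cases "v = 0")
    case False
    \<comment> \<open>The energy along the line through \<open>m\<close> in direction \<open>v\<close> is a quadratic polynomial; the step
      \<open>t\<close> below is its vertex, where the energy is smaller by \<open>(g v - m \<bullet> v)\<^sup>2 / (v \<bullet> v)\<close>.\<close>
    define r where "r = g v - m \<bullet> v"
    define t where "t = r / (v \<bullet> v)"
    have "J (m + t *\<^sub>R v) = J m - 2 * t * r + t * t * (v \<bullet> v)"
      unfolding J_def r_def
      by (simp add: g.scaleR g.add inner_add_left inner_add_right inner_commute algebra_simps)
    also have "t * t * (v \<bullet> v) = t * r"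
      using False unfolding t_def by simp
    finally have "t * r \<le> 0"
      using min[of "m + t *\<^sub>R v"] by (simp add: mult.commute)
    moreover have "v \<bullet> v > 0"
      using False by simp
    ultimately have "r\<^sup>2 \<le> 0"
      unfolding t_def by (simp add: power2_eq_square divide_le_0_iff not_le)
    then show ?thesis unfolding r_def by simp
  qed (simp add: g.zero)
  then show thesis by (rule that)
qed

text \<open>The vector \<open>adjoint A z\<close> is the Riesz representative of the functional \<open>\<lambda>x. A x \<bullet> z\<close>.\<close>

lemma inner_adjoint:
  fixes A :: "'a::{real_inner, complete_space} \<Rightarrow> 'b::real_inner"
  assumes "bounded_linear A"
  shows "A x \<bullet> z = x \<bullet> adjoint A z"
proof -
  have "\<exists>m. \<forall>v. A v \<bullet> z = m \<bullet> v" for z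
  proof -
    have "bounded_linear (\<lambda>v. A v \<bullet> z)"
      using assms by (rule bounded_linear_inner_left_comp)
    then show ?thesis by (metis riesz_representation)
  qed
  then have "\<exists>A'. \<forall>x z. A x \<bullet> z = x \<bullet> A' z"
    by (metis inner_commute)
  from someI_ex[OF this] show ?thesis
    unfolding adjoint_def by blast
qed

text \<open>
  Testing the adjoint identity with \<open>w = A\<^sup>* z - A\<^sup>* z'\<close> itself gives
  \<open>\<parallel>w\<parallel>\<^sup>2 = A w \<bullet> (z - z')\<close>, and Cauchy-Schwarz cancels one factor \<open>\<parallel>w\<parallel>\<close>.
\<close>

lemma norm_adjoint_diff_le:
  fixes A :: "'a::{real_inner, complete_space} \<Rightarrow> 'b::real_inner"
  assumes "bounded_linear A"
  shows "norm (adjoint A z - adjoint A z') \<le> onorm A * norm (z - z')"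
proof -
  define w where "w = adjoint A z - adjoint A z'"
  have "norm w * norm w = w \<bullet> w"
    by (metis power2_eq_square power2_norm_eq_inner)
  also have "\<dots> = A w \<bullet> (z - z')"
    using inner_adjoint[OF assms, of w] by (simp add: w_def inner_diff_right)
  also have "\<dots> \<le> norm (A w) * norm (z - z')"
    by (rule norm_cauchy_schwarz)
  also have "\<dots> \<le> (onorm A * norm w) * norm (z - z')"
    by (intro mult_right_mono onorm assms) auto
  finally have "norm w * norm w \<le> norm w * (onorm A * norm (z - z'))"
    by (simp add: mult_ac)
  moreover have "0 \<le> onorm A * norm (z - z')"
    by (intro mult_nonneg_nonneg onorm_pos_le assms) auto
  ultimately show ?thesis
    unfolding w_def[symmetric] by (cases "w = 0") auto
qed

section \<open>Invertible residual networks\<close>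

text \<open>Solving \<open>x - f x = z\<close> means finding a fixed point of the contraction \<open>x \<mapsto> z + f x\<close>.\<close>

lemma surj_iresnet:
  fixes f :: "'t \<Rightarrow> real \<Rightarrow> 'a::{real_normed_vector, complete_space} \<Rightarrow> 'a"
  assumes "l-lipschitz_on UNIV (f \<theta> l)" "l < 1"
  shows "surj (iresnet f \<theta> l)"
proof -
  have "\<exists>x. z = iresnet f \<theta> l x" for z
  proof -
    have "\<exists>!x. z + f \<theta> l x = x"
      using assms by (intro banach_fix_type[of l]) (auto simp: lipschitz_on_def)
    then obtain x where "z + f \<theta> l x = x" by blast
    then show ?thesis by (auto simp: iresnet_def algebra_simps)
  qed
  then show ?thesis by (auto simp: surj_def)
qed

lemma iresnet_expansive:
  assumes "l-lipschitz_on UNIV (f \<theta> l)"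
  shows "(1 - l) * norm (u - v) \<le> norm (iresnet f \<theta> l u - iresnet f \<theta> l v)"
proof -
  have "norm (f \<theta> l u - f \<theta> l v) \<le> l * norm (u - v)"
    using lipschitz_onD[OF assms, of u v] by (simp add: dist_norm)
  moreover have "norm (u - v) - norm (f \<theta> l u - f \<theta> l v)
      \<le> norm ((u - v) - (f \<theta> l u - f \<theta> l v))"
    by (rule norm_triangle_ineq2)
  ultimately show ?thesis
    by (simp add: iresnet_def algebra_simps)
qed

section \<open>Error estimate and convergence\<close>

text \<open>
  Noise in the data and the approximation error of the network at the sought solution enter
  additively, the noise scaled by the operator norm of \<open>A\<close>, and both are amplified by the
  Lipschitz constant \<open>1 / (1 - l)\<close> of the inverse network.
\<close>

lemma reconstruction_error:
  fixes A :: "'a::{real_inner, complete_space} \<Rightarrow> 'b::real_inner"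
  assumes A: "bounded_linear A"
    and f: "l-lipschitz_on UNIV (f (\<theta> l) l)" and l: "l < 1"
  shows "norm (reconstruction A f \<theta> l z - x)
    \<le> (onorm A * norm (z - A x) + norm (adjoint A (A x) - iresnet f (\<theta> l) l x)) / (1 - l)"
proof -
  define \<phi> where "\<phi> = iresnet f (\<theta> l) l"
  define u where "u = reconstruction A f \<theta> l z"
  have "\<phi> u = adjoint A z"
    unfolding u_def \<phi>_def reconstruction_def o_def
    by (rule surj_f_inv_f[OF surj_iresnet[of l f "\<theta> l", OF f l]])
  then have "(1 - l) * norm (u - x) \<le> norm (adjoint A z - \<phi> x)"
    using iresnet_expansive[of l f "\<theta> l", OF f, of u x] by (simp add: \<phi>_def)
  also have "\<dots> \<le> norm (adjoint A z - adjoint A (A x)) + norm (adjoint A (A x) - \<phi> x)"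
    using norm_triangle_ineq[of "adjoint A z - adjoint A (A x)" "adjoint A (A x) - \<phi> x"] by simp
  also have "\<dots> \<le> onorm A * norm (z - A x) + norm (adjoint A (A x) - \<phi> x)"
    using norm_adjoint_diff_le[OF A] by simp
  finally show ?thesis
    using l unfolding u_def \<phi>_def by (simp add: field_simps)
qed

theorem theorem3p1:
  fixes A :: "'x::{real_inner, complete_space} \<Rightarrow> 'y::{real_inner, complete_space}"
    and \<Theta> :: "real \<Rightarrow> 't set"
    and f :: "'t \<Rightarrow> real \<Rightarrow> 'x \<Rightarrow> 'x"
    and \<theta> :: "real \<Rightarrow> 't"
    and \<psi> :: "real \<Rightarrow> real"
    and x_dag :: 'x and y :: 'y
    and y_noisy :: "real \<Rightarrow> 'y"
    and L :: "real \<Rightarrow> real"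
  assumes "bounded_linear A" and "onorm A = 1"
    and "residual_family \<Theta> f"
    and "y \<in> range A" and "A x_dag = y"
    and "\<And>\<delta>. \<delta> > 0 \<Longrightarrow> norm (y_noisy \<delta> - y) \<le> \<delta>"
    and "\<And>l. l \<in> {0..<1} \<Longrightarrow> \<theta> l \<in> \<Theta> l"
    and "index_function \<psi>"
    and "(\<lambda>l. norm (adjoint A (A x_dag) - iresnet f (\<theta> l) l x_dag))
           \<in> O[at_left 1](\<lambda>l. (1 - l) * \<psi> (1 - l))"
    and "\<And>\<delta>. \<delta> > 0 \<Longrightarrow> L \<delta> \<in> {0..<1}"
    and "(L \<longlongrightarrow> 1) (at_right 0)"
    and "((\<lambda>\<delta>. \<delta> / (1 - L \<delta>)) \<longlongrightarrow> 0) (at_right 0)"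
  shows "((\<lambda>\<delta>. norm (reconstruction A f \<theta> (L \<delta>) (y_noisy \<delta>) - x_dag)) \<longlongrightarrow> 0) (at_right 0)"
proof -
  define E where "E l = norm (adjoint A (A x_dag) - iresnet f (\<theta> l) l x_dag)" for l
  have pos: "\<forall>\<^sub>F \<delta> in at_right 0. \<delta> > (0::real)"
    by (rule eventually_at_right_less)
  have L_left: "filterlim L (at_left 1) (at_right 0)"
    using assms(11) by (rule tendsto_imp_filterlim_at_left)
      (use pos assms(10) in \<open>auto elim!: eventually_mono\<close>)
  obtain C where C: "\<forall>\<^sub>F l in at_left 1. norm (E l) \<le> C * norm ((1 - l) * \<psi> (1 - l))"
    using assms(9) unfolding E_def[symmetric] by (elim landau_o.bigE)
  have approx: "\<forall>\<^sub>F \<delta> in at_right 0. E (L \<delta>) \<le> C * ((1 - L \<delta>) * \<psi> (1 - L \<delta>))"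
    using filterlim_iff[THEN iffD1, OF L_left, rule_format, OF C] pos
  proof eventually_elim
    case (elim \<delta>)
    have "0 \<le> \<psi> (1 - L \<delta>)"
      using assms(8) assms(10)[OF elim(2)] unfolding index_function_def
      by (auto simp: image_subset_iff)
    then show ?case
      using elim(1) assms(10)[OF elim(2)] by (auto simp: abs_mult)
  qed
  have bound: "\<forall>\<^sub>F \<delta> in at_right 0. norm (reconstruction A f \<theta> (L \<delta>) (y_noisy \<delta>) - x_dag)
      \<le> \<delta> / (1 - L \<delta>) + C * \<psi> (1 - L \<delta>)"
    using approx pos
  proof eventually_elim
    case (elim \<delta>)
    let ?l = "L \<delta>"
    have l: "?l \<in> {0..<1}" using assms(10) elim(2) .
    have lip: "?l-lipschitz_on UNIV (f (\<theta> ?l) ?l)"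
      using assms(3) assms(7)[OF l] l unfolding residual_family_def by blast
    have "norm (reconstruction A f \<theta> ?l (y_noisy \<delta>) - x_dag)
        \<le> (norm (y_noisy \<delta> - y) + E ?l) / (1 - ?l)"
      using reconstruction_error[of A ?l f \<theta> "y_noisy \<delta>" x_dag, OF assms(1) lip] l
      by (simp add: assms(2,5) E_def)
    also have "\<dots> \<le> (\<delta> + C * ((1 - ?l) * \<psi> (1 - ?l))) / (1 - ?l)"
      using l assms(6)[OF elim(2)] elim(1) by (intro divide_right_mono add_mono) auto
    also have "\<dots> = \<delta> / (1 - ?l) + C * \<psi> (1 - ?l)"
      using l by (simp add: add_divide_distrib)
    finally show ?case .
  qed
  have "((\<lambda>\<delta>. \<psi> (1 - L \<delta>)) \<longlongrightarrow> \<psi> 0) (at_right 0)"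
  proof (rule continuous_on_tendsto_compose[of _ \<psi>])
    show "continuous_on {0..} \<psi>"
      using assms(8) unfolding index_function_def by blast
    show "((\<lambda>\<delta>. 1 - L \<delta>) \<longlongrightarrow> 0) (at_right 0)"
      using tendsto_diff[OF tendsto_const assms(11), of 1] by simp
    show "\<forall>\<^sub>F \<delta> in at_right 0. 1 - L \<delta> \<in> {0..}"
      using pos assms(10) by (auto elim!: eventually_mono simp: less_imp_le)
  qed simp
  from tendsto_add[OF assms(12) tendsto_mult_left[OF this]]
  have "((\<lambda>\<delta>. \<delta> / (1 - L \<delta>) + C * \<psi> (1 - L \<delta>)) \<longlongrightarrow> 0 + C * \<psi> 0) (at_right 0)" .
  then have "((\<lambda>\<delta>. \<delta> / (1 - L \<delta>) + C * \<psi> (1 - L \<delta>)) \<longlongrightarrow> 0) (at_right 0)"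
    using assms(8) unfolding index_function_def by simp
  then show ?thesis
    by (rule tendsto_sandwich[OF _ bound tendsto_const, rotated]) simp
qed

end
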